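(* A number $N$ is an even perfect number if and only if $N = 2^{p-1}(2^p-1)$ for some prime $p$, and $$2n-1 \ \Big|\ \sum_{\substack{k=0\\ k \text{ even}}}^{\lfloor n/2\rfloor} (-1)^{\lfloor k/2\rfloor}\, \frac{\prod_{\lambda=0}^{\lfloor k/2\rfloor-1}\left[n^2-(4\lambda)^2\right]}{k!},$$ where $n := 2^{p-1}$.
   Context: A perfect number is a positive integer equal to the sum of its proper positive divisors. The empty product $\prod_{\lambda=0}^{-1}$ (which occurs for $k=0$) equals $1$.
   Formalization: The formal theorem assumes N ≠ 6: for N = 6 (p = 2, n = 2) the sum equals 1, which 3 does not divide although 6 is an even perfect number, so the stated equivalence fails at exactly that number. *)

theory Defs
  imports Complex_Main "HOL-Computational_Algebra.Primes"
begin

definition perfect :: "nat \<Rightarrow> bool" where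
  "perfect n \<longleftrightarrow> n > 0 \<and> \<Sum>{d. d dvd n \<and> d < n} = n"

text \<open>
  The sum is taken over the rationals because its terms are written as fractions; an integer
  divides it when it is the image of an integer multiple. The product is empty for \<open>k = 0\<close>.
\<close>

definition alternating_sum :: "nat \<Rightarrow> rat" where
  "alternating_sum n =
     (\<Sum>k | k \<le> n div 2 \<and> even k.
        (-1) ^ (k div 2) * ((\<Prod>l<k div 2. (of_nat n)\<^sup>2 - (4 * of_nat l)\<^sup>2) / fact k))"

definition int_dvd_rat :: "int \<Rightarrow> rat \<Rightarrow> bool" where
  "int_dvd_rat m q \<longleftrightarrow> (\<exists>s::int. q = of_int s \<and> m dvd s)"

end

theory Submission
  imports Defs "HOL-Number_Theory.Quadratic_Reciprocity"
begin

text \<open>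
  Writing \<open>n = 4 m\<close>, the sum is the expansion of \<open>cos (2 m \<theta>)\<close> in powers of \<open>sin\<^sup>2 \<theta>\<close>, formally
  evaluated at \<open>sin\<^sup>2 \<theta> = 4\<close>. There \<open>cos (2 \<theta>) = -7\<close>, so up to sign the sum is \<open>T\<^sub>m(7)\<close>, the rational
  part of \<open>(2 + \<surd>3) ^ (2 m)\<close>. For \<open>n = 2 ^ (p - 1)\<close> this is half the Lucas-Lehmer residue, so
  the divisibility says precisely that \<open>2 ^ p - 1\<close> passes the Lucas-Lehmer test, and the theorem is
  the Euclid-Euler theorem. The exponent \<open>p = 2\<close>, where the test fails although 3 is prime,
  is the case \<open>N = 6\<close>.
\<close>

section \<open>The ring of integers with an adjoined square root of 3\<close>

text \<open>Formal pairs instead of real numbers: here \<open>dvd\<close> is divisibility inside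
  Z[sqrt 3], so it expresses congruences; in the field of reals it would be trivial.\<close>

datatype zsqrt3 = ZSqrt3 (re: int) (im: int)

lemma zsqrt3_eq_iff: "x = y \<longleftrightarrow> re x = re y \<and> im x = im y"
  by (cases x; cases y) simp

instantiation zsqrt3 :: comm_ring_1
begin

definition "0 = ZSqrt3 0 0"
definition "1 = ZSqrt3 1 0"
definition "x + y = ZSqrt3 (re x + re y) (im x + im y)"
definition "x - y = ZSqrt3 (re x - re y) (im x - im y)"
definition "- x = ZSqrt3 (- re x) (- im x)"
definition "x * y = ZSqrt3 (re x * re y + 3 * im x * im y) (re x * im y + im x * re y)"

instance
  by standard
    (simp_all add: zsqrt3_eq_iff zero_zsqrt3_def one_zsqrt3_def plus_zsqrt3_def minus_zsqrt3_def
      uminus_zsqrt3_def times_zsqrt3_def algebra_simps)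

end

lemma re_im_simps [simp]:
  "re 0 = 0" "im 0 = 0" "re 1 = 1" "im 1 = 0"
  "re (x + y) = re x + re y" "im (x + y) = im x + im y"
  "re (x - y) = re x - re y" "im (x - y) = im x - im y"
  "re (- x) = - re x" "im (- x) = - im x"
  "re (x * y) = re x * re y + 3 * im x * im y" "im (x * y) = re x * im y + im x * re y"
  by (simp_all add: zero_zsqrt3_def one_zsqrt3_def plus_zsqrt3_def minus_zsqrt3_def
      uminus_zsqrt3_def times_zsqrt3_def)

lemma re_im_of_nat [simp]: "re (of_nat n) = int n" "im (of_nat n) = 0"
  by (induction n) simp_all

lemma re_im_of_int [simp]: "re (of_int k) = k" "im (of_int k) = 0"
  by (cases k rule: int_diff_cases; simp)+

lemma re_im_numeral [simp]: "re (numeral k) = numeral k" "im (numeral k) = 0"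
  using re_im_of_nat[of "numeral k"] by simp_all

lemma of_int_dvd_zsqrt3_iff:
  "(of_int q :: zsqrt3) dvd x \<longleftrightarrow> q dvd re x \<and> q dvd im x"
proof
  assume "q dvd re x \<and> q dvd im x"
  then obtain a b where "re x = q * a" "im x = q * b" by (auto elim!: dvdE)
  then have "x = of_int q * ZSqrt3 a b" by (simp add: zsqrt3_eq_iff)
  then show "of_int q dvd x" by simp
qed (auto elim!: dvdE)

lemma diff_dvd_power_diff: "x - y dvd x ^ n - (y :: 'a :: comm_ring_1) ^ n"
  by (simp add: power_diff_sumr2)

lemma dvd_diff_trans:
  fixes q x y z :: "'a :: comm_ring_1"
  assumes "q dvd x - y" "q dvd y - z"
  shows "q dvd x - z"
  using dvd_add[OF assms] by simp

text \<open>The inner binomial coefficients are multiples of \<open>p\<close>. Stated for any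
  commutative ring, this gives the Frobenius map on Z[sqrt 3] modulo a prime without a quotient
  ring.\<close>

lemma prime_dvd_freshman:
  fixes x :: "'a :: comm_ring_1"
  assumes "prime p"
  shows "of_nat p dvd (1 + x) ^ p - (1 + x ^ p)"
proof -
  have p: "p > 0" using assms by (simp add: prime_gt_0_nat)
  have "(1 + x) ^ p = (x + 1) ^ p" by (simp add: add.commute)
  also have "\<dots> = (\<Sum>k\<le>p. of_nat (p choose k) * x ^ k)" by (simp add: binomial_ring)
  also have "{..p} = insert 0 (insert p {0<..<p})" using p by auto
  also have "(\<Sum>k\<in>\<dots>. of_nat (p choose k) * x ^ k) =
      1 + (x ^ p + (\<Sum>k\<in>{0<..<p}. of_nat (p choose k) * x ^ k))"
    using p by simp
  finally have eq: "(1 + x) ^ p - (1 + x ^ p) =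
      (\<Sum>k\<in>{0<..<p}. of_nat (p choose k) * x ^ k)"
    by (simp add: algebra_simps)
  have "(of_nat p :: 'a) dvd of_nat (p choose k)" if "k \<in> {0<..<p}" for k
  proof -
    have "p dvd (p choose k)"
      using that assms by (intro dvd_choose_prime) auto
    then show ?thesis by (auto elim!: dvdE)
  qed
  then show ?thesis unfolding eq by (intro dvd_sum dvd_mult2) auto
qed

text \<open>The norm of 2 + sqrt 3 is 1, so it is a unit with its conjugate
  \<open>ZSqrt3 2 (-1)\<close> as inverse.\<close>

definition omega :: zsqrt3 where "omega = ZSqrt3 2 1"

lemma re_im_omega [simp]: "re omega = 2" "im omega = 1"
  by (simp_all add: omega_def)

lemma omega_unit: "omega ^ n * ZSqrt3 2 (-1) ^ n = 1"
proof -
  have "omega * ZSqrt3 2 (-1) = 1" by (simp add: zsqrt3_eq_iff)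
  then show ?thesis by (simp flip: power_mult_distrib)
qed

lemma omega_norm: "(re (omega ^ n))\<^sup>2 - 3 * (im (omega ^ n))\<^sup>2 = 1"
proof (induction n)
  case (Suc n)
  have "(re (omega ^ Suc n))\<^sup>2 - 3 * (im (omega ^ Suc n))\<^sup>2
      = (re (omega ^ n))\<^sup>2 - 3 * (im (omega ^ n))\<^sup>2"
    by (simp add: power2_eq_square algebra_simps)
  with Suc show ?case by simp
qed simp

text \<open>For s = 2 \<open>re (omega ^ n)\<close> this is the Lucas-Lehmer iteration s -> s^2 - 2,
  with s = 4 at n = 1.\<close>

lemma re_omega_double: "re (omega ^ (2 * n)) = 2 * (re (omega ^ n))\<^sup>2 - 1"
proof -
  have "re (omega ^ (2 * n)) = (re (omega ^ n))\<^sup>2 + 3 * (im (omega ^ n))\<^sup>2"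
    by (simp add: mult_2 power_add power2_eq_square)
  with omega_norm[of n] show ?thesis by simp
qed

lemma im_omega_double: "im (omega ^ (2 * n)) = 2 * re (omega ^ n) * im (omega ^ n)"
  unfolding mult_2 power_add by (simp add: algebra_simps)

section \<open>The Lucas-Lehmer test\<close>

lemma omega_power_cong_one:
  fixes q :: nat
  assumes minus: "of_nat q dvd omega ^ 2 ^ s + 1"
    and one: "of_nat q dvd omega ^ d - 1" and d: "0 < d" "d < 2 ^ Suc s"
  shows "q dvd 2"
proof -
  \<comment> \<open>Modulo \<open>q\<close>, raising \<open>omega ^ d\<close> = 1 to the power
    \<open>2 ^ (s - e)\<close> gives 1, while raising \<open>omega ^ 2 ^ s\<close> = -1 to the odd
    power \<open>u\<close> gives -1. Both have exponent \<open>2 ^ s * u\<close>, so 2 = 0.\<close>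
  obtain e u where eu: "d = 2 ^ e * u" "odd u"
    using d(1) by (metis not_gr_zero multiplicity_decompose' odd_one)
  have "2 ^ e < (2::nat) ^ Suc s"
    using d(2) eu by (metis dvd_def dvd_imp_le le_less_trans d(1))
  then have "e \<le> s" by (meson less_Suc_eq_le nat_power_less_imp_less zero_less_numeral)
  then have exps: "d * 2 ^ (s - e) = 2 ^ s * u"
    by (simp add: eu ac_simps flip: power_add)
  have "of_nat q dvd omega ^ (d * 2 ^ (s - e)) - 1"
    using dvd_trans[OF one diff_dvd_power_diff[of "omega ^ d" 1 "2 ^ (s - e)"]]
    by (simp add: power_mult)
  moreover have "of_nat q dvd omega ^ (2 ^ s * u) + 1"
    using dvd_trans[OF _ diff_dvd_power_diff[of "omega ^ 2 ^ s" "-1" u], of "of_nat q"] minus eu(2)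
    by (simp add: power_mult)
  ultimately have "of_nat q dvd (omega ^ (2 ^ s * u) + 1) - (omega ^ (2 ^ s * u) - 1)"
    unfolding exps by (rule dvd_diff[rotated])
  then have "(of_int (int q) :: zsqrt3) dvd 2" by simp
  then have "int q dvd 2" unfolding of_int_dvd_zsqrt3_iff by simp
  then show ?thesis by presburger
qed

text \<open>The powers of \<open>omega\<close> with exponent below its order \<open>2 ^ Suc s\<close> are distinct and nonzero
  modulo \<open>q\<close>, so there are at most \<open>q\<^sup>2 - 1\<close> of them.\<close>

lemma omega_order_bound:
  fixes q :: nat
  assumes minus: "of_nat q dvd omega ^ 2 ^ s + 1" and q: "q > 2"
  shows "2 ^ Suc s < q\<^sup>2"
proof -
  let ?f = "\<lambda>k. (re (omega ^ k) mod int q, im (omega ^ k) mod int q)"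
  let ?B = "{0..<int q} \<times> {0..<int q} - {(0, 0)}"
  have nq: "\<not> q dvd 2" using q by (auto dest: dvd_imp_le)
  have no: False if "?f i = ?f j" "i < j" "j < 2 ^ Suc s" for i j
  proof -
    have "of_int (int q) dvd omega ^ j - omega ^ i"
      using that(1) unfolding of_int_dvd_zsqrt3_iff by (simp add: mod_eq_dvd_iff dvd_diff_commute)
    \<comment> \<open>Cancelling the unit \<open>omega ^ i\<close> turns a collision of two powers
      into a power with small positive exponent that is 1.\<close>
    then have "of_nat q dvd (omega ^ j - omega ^ i) * ZSqrt3 2 (-1) ^ i"
      by simp
    also have "omega ^ j = omega ^ i * omega ^ (j - i)"
      using that by (simp flip: power_add)
    also have "(omega ^ i * omega ^ (j - i) - omega ^ i) * ZSqrt3 2 (-1) ^ i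
        = (omega ^ i * ZSqrt3 2 (-1) ^ i) * (omega ^ (j - i) - 1)"
      by (simp add: algebra_simps)
    finally have "of_nat q dvd omega ^ (j - i) - 1" by (simp add: omega_unit)
    moreover have "0 < j - i" "j - i < 2 ^ Suc s" using that by linarith+
    ultimately show False using omega_power_cong_one[OF minus] nq by blast
  qed
  have "inj_on ?f {..<2 ^ Suc s}"
    by (rule linorder_inj_onI) (use no in auto)
  moreover have "?f ` {..<2 ^ Suc s} \<subseteq> ?B"
  proof -
    \<comment> \<open>A unit cannot vanish modulo \<open>q\<close>.\<close>
    have "\<not> (int q dvd re (omega ^ k) \<and> int q dvd im (omega ^ k))" for k
    proof
      assume "int q dvd re (omega ^ k) \<and> int q dvd im (omega ^ k)"
      then have "of_int (int q) dvd omega ^ k" unfolding of_int_dvd_zsqrt3_iff .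
      then have "of_int (int q) dvd omega ^ k * ZSqrt3 2 (-1) ^ k" by (rule dvd_mult2)
      then have "int q dvd 1" unfolding omega_unit of_int_dvd_zsqrt3_iff by simp
      with q show False by simp
    qed
    with q show ?thesis by auto
  qed
  ultimately have "2 ^ Suc s \<le> card ?B"
    using card_inj_on_le[of ?f "{..<2 ^ Suc s}" ?B] by simp
  also have "card ?B = q * q - 1" using q by (simp add: card_cartesian_product)
  also have "q * q - 1 < q\<^sup>2" using q by (simp add: power2_eq_square)
  finally show ?thesis .
qed

lemma dvd_omega_power_plus_one:
  assumes "q dvd re (omega ^ n)"
  shows "of_int q dvd omega ^ (2 * n) + 1"
  using assms unfolding of_int_dvd_zsqrt3_iff
  by (simp add: re_omega_double im_omega_double power2_eq_square)

text \<open>A composite M = 2^p - 1 has a divisor \<open>q\<close> > 1 with q^2 <= M. Modulo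
  \<open>q\<close> the order of \<open>omega\<close> is 2^p, more than the number of nonzero residue
  classes of Z[sqrt 3].\<close>

lemma Lucas_Lehmer_sufficient:
  assumes p: "p \<ge> 2" and dvd: "int (2 ^ p - 1) dvd re (omega ^ 2 ^ (p - 2))"
  shows "prime (2 ^ p - 1 :: nat)"
proof (rule ccontr)
  define M :: nat where "M = 2 ^ p - 1"
  assume "\<not> prime (2 ^ p - 1 :: nat)"
  then have np: "\<not> prime M" by (simp add: M_def)
  have "(2::nat) ^ 2 \<le> 2 ^ p" using p by (intro power_increasing) auto
  then have M1: "M > 1" and oddM: "odd M" using p by (auto simp: M_def)
  from np M1 obtain a where a: "a dvd M" "a \<noteq> 1" "a \<noteq> M" by (auto simp: prime_nat_iff)
  then obtain b where ab: "M = a * b" by (auto elim!: dvdE)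
  define q where "q = min a b"
  have qM: "q dvd M" using ab by (auto simp: q_def min_def)
  have "a \<noteq> 0" "b \<noteq> 0" using M1 unfolding ab by (auto intro!: gr0I)
  moreover have "b \<noteq> 1" using a ab by auto
  ultimately have "q > 1" using a(2) by (simp add: q_def min_def)
  moreover have "odd q" using oddM qM by auto
  ultimately have q2: "q > 2" by (cases "q = 2") auto
  have "q * q \<le> a * b" by (intro mult_mono) (auto simp: q_def)
  then have le: "q\<^sup>2 < 2 ^ p" using ab M1 by (simp add: power2_eq_square M_def)
  obtain s where s: "p = Suc (Suc s)" using p by (metis add_2_eq_Suc le_Suc_ex)
  have "int q dvd re (omega ^ 2 ^ s)"
  proof (rule dvd_trans)
    show "int q dvd int M" using qM by simp
    show "int M dvd re (omega ^ 2 ^ s)" using dvd unfolding M_def s by simp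
  qed
  from dvd_omega_power_plus_one[OF this] have "of_nat q dvd omega ^ 2 ^ Suc s + 1"
    by simp
  from omega_order_bound[OF this q2] le show False by (simp add: s)
qed

section \<open>Necessity of the test\<close>

lemma mersenne_mod_12:
  assumes "odd p" "p \<ge> 3"
  shows "(2 ^ p - 1 :: int) mod 12 = 7"
proof -
  obtain k where "p = 2 * k + 1" using assms(1) by (elim oddE)
  then have i: "p = 2 * (k - 1) + 3" using assms(2) by simp
  have "(4 ^ i * 8 :: int) mod 12 = 8" for i :: nat
  proof (induction i)
    case (Suc i)
    have "(4 ^ Suc i * 8 :: int) mod 12 = 4 * (4 ^ i * 8 mod 12) mod 12"
      by (simp only: mod_mult_right_eq power_Suc mult.assoc)
    with Suc show ?case by simp
  qed simp
  then have "(2::int) ^ p mod 12 = 8"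
    by (simp add: i power_add power_mult)
  then show ?thesis by presburger
qed

text \<open>By Euler's criterion, 3 has to be a nonresidue. Since q = 3 modulo 4, reciprocity
  contributes the sign -1, and since q = 1 modulo 3, \<open>q\<close> is a square modulo 3.\<close>

lemma three_power_dvd_plus_one:
  fixes q :: nat
  assumes "prime q" "int q mod 12 = 7"
  shows "int q dvd 3 ^ ((q - 1) div 2) + 1"
proof -
  define j where "j = q div 12"
  have "int (q mod 12) = 7" using assms(2) by (simp add: zmod_int)
  then have j: "q = 12 * j + 7"
    using mult_div_mod_eq[of 12 q] unfolding j_def by linarith
  then have q: "q > 2" "q \<noteq> 3" by simp_all
  have "Legendre 3 q * Legendre q 3 = (-1) ^ ((3 - 1) div 2 * ((q - 1) div 2))"
    using Quadratic_Reciprocity[of 3 q] assms(1) q by simp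
  also have "(3 - 1) div 2 * ((q - 1) div 2) = 2 * (3 * j + 1) + 1" by (simp add: j)
  finally have "Legendre 3 q * Legendre q 3 = -1" by simp
  moreover have "Legendre q 3 = 1"
  proof -
    have "(12 * int j + 7) mod 3 = 1" by presburger
    then have "int q mod 3 = 1" by (simp add: j)
    then have "QuadRes 3 q" "\<not> [int q = 0] (mod 3)"
      unfolding QuadRes_def by (auto simp: cong_def intro: exI[of _ 1])
    then show ?thesis by (simp add: Legendre_def)
  qed
  ultimately have "Legendre 3 q = -1" by simp
  with euler_criterion[OF assms(1) q(1), of 3] have "[3 ^ ((q - 1) div 2) = (-1::int)] (mod int q)"
    by (simp add: cong_sym_eq)
  then show ?thesis by (simp add: cong_iff_dvd_diff)
qed

text \<open>For q = 2^p - 1 the exponent is (q - 1) / 2. Modulo \<open>q\<close>, 2 equals 2^(p+1),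
  the square of 2^((p+1)/2) because \<open>p\<close> is odd, so Fermat's theorem for that root
  suffices.\<close>

lemma two_power_mersenne:
  assumes "prime (2 ^ p - 1 :: nat)" "odd p" "p \<ge> 3"
  shows "2 ^ p - 1 dvd (2 :: int) ^ (2 ^ (p - 1) - 1) - 1"
proof -
  define q :: nat where "q = 2 ^ p - 1"
  obtain i where i: "p = 2 * i + 1" using assms(2) by (elim oddE)
  have iq: "int q = 2 ^ p - 1" by (simp add: q_def of_nat_diff)
  have half: "q - 1 = 2 * (2 ^ (p - 1) - 1)"
    using assms(3) by (cases p) (simp_all add: q_def)
  have sq: "Suc p = (i + 1) * 2" by (simp add: i)
  have nd: "\<not> q dvd 2 ^ (i + 1)"
  proof
    assume "q dvd 2 ^ (i + 1)"
    then have "q dvd 2" using assms(1) prime_dvd_power_nat unfolding q_def by blast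
    then have "q \<le> 2" by (rule dvd_imp_le) simp
    moreover have "(2::nat) ^ 3 \<le> 2 ^ p" using assms(3) by (intro power_increasing) auto
    ultimately show False by (simp add: q_def)
  qed
  have "[(2 ^ (i + 1)) ^ (q - 1) = (1::nat)] (mod q)"
    by (rule fermat_theorem) (use assms(1) nd in \<open>simp_all add: q_def\<close>)
  then have "[int ((2 ^ (i + 1)) ^ (q - 1)) = int 1] (mod int q)"
    by (subst cong_int_iff)
  then have "int q dvd (2 ^ (i + 1)) ^ (q - 1) - 1" by (simp add: cong_iff_dvd_diff)
  also have "(2 ^ (i + 1)) ^ (q - 1) = ((2::int) ^ Suc p) ^ (2 ^ (p - 1) - 1)"
    unfolding half sq power_mult ..
  finally have "int q dvd ((2::int) ^ Suc p) ^ (2 ^ (p - 1) - 1) - 1" .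
  moreover have "int q dvd 2 ^ (2 ^ (p - 1) - 1) - ((2::int) ^ Suc p) ^ (2 ^ (p - 1) - 1)"
  proof (rule dvd_trans[OF _ diff_dvd_power_diff])
    have "2 - 2 ^ Suc p = int q * (-2)" by (simp add: iq)
    then show "int q dvd 2 - 2 ^ Suc p" by (metis dvd_triv_left)
  qed
  ultimately show ?thesis using dvd_diff_trans iq by metis
qed

text \<open>Compute \<open>(1 + \<surd>3) ^ (q + 1)\<close> modulo \<open>q\<close> in two ways: with the
  Frobenius map it is \<open>(1 - \<surd>3) (1 + \<surd>3) = -2\<close>, and with \<open>(1 + \<surd>3)\<^sup>2 = 2 omega\<close> it is
  \<open>2 omega ^ 2 ^ (p - 1)\<close>.\<close>

lemma Lucas_Lehmer_necessary:
  assumes "prime (2 ^ p - 1 :: nat)" "odd p" "p \<ge> 3"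
  shows "int (2 ^ p - 1) dvd re (omega ^ 2 ^ (p - 2))"
proof -
  define q :: nat where "q = 2 ^ p - 1"
  define h :: nat where "h = 2 ^ (p - 1)"
  define r :: zsqrt3 where "r = ZSqrt3 0 1"
  have q: "prime q" using assms(1) by (simp add: q_def)
  have iq: "int q = 2 ^ p - 1" by (simp add: q_def of_nat_diff)
  have oddq: "odd q" using assms(3) by (simp add: q_def)
  have qh: "q + 1 = 2 * h" "h > 0" using assms(3) by (cases p; simp add: q_def h_def)+
  then have half: "(q - 1) div 2 = h - 1" "q = 2 * (h - 1) + 1" by simp_all
  have r2: "r * r = 3" by (simp add: zsqrt3_eq_iff r_def)
  have rq: "r ^ q = of_int (3 ^ (h - 1)) * r"
    by (simp add: half(2) power_mult power2_eq_square r2)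
  \<comment> \<open>As 3 is a nonresidue, the Frobenius map sends sqrt 3 to its conjugate.\<close>
  have Q3: "of_nat q dvd r ^ q - (- r)"
  proof -
    have "int q dvd 3 ^ (h - 1) + 1"
      using three_power_dvd_plus_one[OF q] mersenne_mod_12[OF assms(2,3)]
      unfolding half(1) iq by simp
    then obtain c where c: "3 ^ (h - 1) + 1 = int q * c" by (elim dvdE)
    have "r ^ q - (- r) = of_int (3 ^ (h - 1) + 1) * r"
      unfolding rq by (simp add: algebra_simps)
    then show ?thesis unfolding c by simp
  qed
  have "of_nat q dvd (1 + r) ^ q - (1 - r)"
    using dvd_add[OF prime_dvd_freshman[OF q, of r] Q3] by (simp add: algebra_simps)
  then have "of_nat q dvd ((1 + r) ^ q - (1 - r)) * (1 + r)" by (rule dvd_mult2)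
  also have "((1 + r) ^ q - (1 - r)) * (1 + r) = (1 + r) ^ (q + 1) + 2"
    using r2 by (simp add: algebra_simps)
  also have "(1 + r) ^ (q + 1) = (2 * omega) ^ h"
    unfolding qh power_mult by (rule arg_cong[of _ _ "\<lambda>x. x ^ h"])
      (simp add: zsqrt3_eq_iff power2_eq_square r_def)
  also have "\<dots> = 2 * of_int (2 ^ (h - 1)) * omega ^ h"
    using qh(2) by (cases h) (simp_all add: power_mult_distrib)
  finally have A: "of_nat q dvd 2 * of_int (2 ^ (h - 1)) * omega ^ h + 2" .
  \<comment> \<open>The factor \<open>2 ^ (h - 1)\<close> in \<open>A\<close> is 1 modulo
    \<open>q\<close> and can be removed.\<close>
  have "int q dvd 2 ^ (h - 1) - 1"
    using two_power_mersenne[OF assms] unfolding iq h_def .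
  then obtain c where c: "2 ^ (h - 1) - 1 = int q * c" by (elim dvdE)
  have "of_nat q dvd of_int (2 ^ (h - 1) - 1) * (2 * omega ^ h)" unfolding c by simp
  from dvd_diff[OF A this] have "of_nat q dvd 2 * omega ^ h + 2"
    by (simp add: algebra_simps)
  then have "of_int (int q) dvd 2 * omega ^ h + 2" by simp
  then have "int q dvd 2 * re (omega ^ h) + 2" unfolding of_int_dvd_zsqrt3_iff by simp
  also have "h = 2 * 2 ^ (p - 2)"
    using assms(3) by (simp add: h_def flip: power_Suc)
  \<comment> \<open>With x the value at half the exponent, 2 (2 x^2 - 1) + 2 = 4 x^2, so the odd
    prime \<open>q\<close> divides x.\<close>
  also have "2 * re (omega ^ (2 * 2 ^ (p - 2))) + 2 = 2\<^sup>2 * (re (omega ^ 2 ^ (p - 2)))\<^sup>2"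
    by (simp add: re_omega_double)
  finally have "int q dvd 2\<^sup>2 * (re (omega ^ 2 ^ (p - 2)))\<^sup>2" .
  moreover have "coprime (int q) (2\<^sup>2)" using oddq unfolding coprime_power_right_iff by simp
  ultimately have "int q dvd (re (omega ^ 2 ^ (p - 2)))\<^sup>2"
    by (simp add: coprime_dvd_mult_right_iff)
  moreover have "prime (int q)" using q by simp
  ultimately have "int q dvd re (omega ^ 2 ^ (p - 2))" by (rule prime_dvd_power[rotated])
  then show ?thesis by (simp only: q_def)
qed

section \<open>The alternating sum as a Chebyshev polynomial value\<close>

text \<open>The coefficient of (2 (x - 1))^j in the Chebyshev polynomial T_m(x).\<close>

definition cheb_coeff :: "nat \<Rightarrow> nat \<Rightarrow> rat" where
  "cheb_coeff m j = (\<Prod>l<j. (of_nat m)\<^sup>2 - (of_nat l)\<^sup>2) / fact (2 * j)"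

lemma cheb_coeff_0 [simp]: "cheb_coeff m 0 = 1"
  by (simp add: cheb_coeff_def)

lemma cheb_coeff_eq_0: "m < j \<Longrightarrow> cheb_coeff m j = 0"
  by (auto simp: cheb_coeff_def)

text \<open>For j > 0 the product of x^2 - l^2 is \<open>x\<close> times the product of the
  consecutive terms from x - j + 1 to x + j - 1, so a shift by 1 changes only the outer factors. The
  factor \<open>x\<close> on the left replaces a division.\<close>

lemma prod_square_diff_shift_up:
  fixes x :: "'a :: idom" and j :: nat
  shows "(\<Prod>l<Suc j. (x + 1)\<^sup>2 - (of_nat l)\<^sup>2) * x =
    (x + 1) * (x + of_nat j) * (x + of_nat j + 1) * (\<Prod>l<j. x\<^sup>2 - (of_nat l)\<^sup>2)"
proof (induction j)
  case (Suc j)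
  have "(\<Prod>l<Suc (Suc j). (x + 1)\<^sup>2 - (of_nat l)\<^sup>2) * x =
      ((\<Prod>l<Suc j. (x + 1)\<^sup>2 - (of_nat l)\<^sup>2) * x) * ((x + 1)\<^sup>2 - (of_nat (Suc j))\<^sup>2)"
    by simp
  also have "\<dots> = (x + 1) * (x + of_nat (Suc j)) * (x + of_nat (Suc j) + 1) *
      ((\<Prod>l<j. x\<^sup>2 - (of_nat l)\<^sup>2) * (x\<^sup>2 - (of_nat j)\<^sup>2))"
    unfolding Suc by (simp add: power2_eq_square algebra_simps)
  finally show ?case by simp
qed (simp add: power2_eq_square)

lemma prod_square_diff_shift_down:
  fixes x :: "'a :: idom" and j :: nat
  shows "(\<Prod>l<Suc j. (x - 1)\<^sup>2 - (of_nat l)\<^sup>2) * x =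
    (x - 1) * (x - of_nat j) * (x - of_nat j - 1) * (\<Prod>l<j. x\<^sup>2 - (of_nat l)\<^sup>2)"
proof -
  have sq: "(- x + 1)\<^sup>2 = (x - 1)\<^sup>2" by (simp add: power2_eq_square algebra_simps)
  show ?thesis
    using prod_square_diff_shift_up[of "- x" j] unfolding sq by (simp add: algebra_simps)
qed

text \<open>This is the recurrence \<open>T\<^sub>m\<^sub>+\<^sub>2 + T\<^sub>m = 2 x T\<^sub>m\<^sub>+\<^sub>1\<close> of the Chebyshev polynomials, read off
  coefficientwise in powers of \<open>2 (x - 1)\<close>.\<close>

lemma cheb_coeff_rec:
  "cheb_coeff (Suc (Suc m)) (Suc j) + cheb_coeff m (Suc j) =
    2 * cheb_coeff (Suc m) (Suc j) + cheb_coeff (Suc m) j"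
proof -
  define x :: rat where "x = of_nat (Suc m)"
  define P where "P = (\<lambda>y j. \<Prod>l<j. (y::rat)\<^sup>2 - (of_nat l)\<^sup>2)"
  have x: "x \<noteq> 0" "of_nat (Suc (Suc m)) = x + 1" "of_nat m = x - 1"
    unfolding x_def by (simp_all del: of_nat_Suc add: of_nat_Suc[of "Suc m"])
  \<comment> \<open>After multiplication by \<open>x\<close> every term is a multiple of
    \<open>P x j\<close>, leaving a polynomial identity in x and j. The factor (2j + 2)(2j + 1) is
    the quotient of the two factorials.\<close>
  have "(P (x + 1) (Suc j) + P (x - 1) (Suc j)) * x =
      (2 * P x (Suc j) + (2 * of_nat j + 2) * (2 * of_nat j + 1) * P x j) * x"
    unfolding distrib_right[of "P (x + 1) (Suc j)"] unfolding P_def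
    unfolding prod_square_diff_shift_up prod_square_diff_shift_down
    by (simp add: power2_eq_square algebra_simps)
  then have *: "P (x + 1) (Suc j) + P (x - 1) (Suc j) =
      2 * P x (Suc j) + (2 * of_nat j + 2) * (2 * of_nat j + 1) * P x j"
    using x(1) by simp
  have c: "cheb_coeff k j = P (of_nat k) j / fact (2 * j)" for k j
    by (simp add: cheb_coeff_def P_def)
  have f: "fact (2 * Suc j) = ((2 * of_nat j + 2) * (2 * of_nat j + 1) * fact (2 * j) :: rat)"
    by (simp add: algebra_simps)
  have "(2 * of_nat j + 2) * (2 * of_nat j + 1) = (of_nat ((2 * j + 2) * (2 * j + 1)) :: rat)"
    by (simp add: algebra_simps)
  then have nz: "(2 * of_nat j + 2) * (2 * of_nat j + 1) \<noteq> (0 :: rat)"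
    by (simp only: of_nat_eq_0_iff) simp
  have "cheb_coeff (Suc (Suc m)) (Suc j) + cheb_coeff m (Suc j) =
      (P (x + 1) (Suc j) + P (x - 1) (Suc j)) / fact (2 * Suc j)"
    unfolding c x by (simp only: add_divide_distrib)
  also have "\<dots> = 2 * (P x (Suc j) / fact (2 * Suc j)) + P x j / fact (2 * j)"
    unfolding * f add_divide_distrib
    by (simp only: nonzero_mult_divide_mult_cancel_left[OF nz] times_divide_eq_right)
  finally show ?thesis by (simp only: c x_def)
qed

text \<open>At 2 (x - 1) = -16, that is x = -7, this truncates T_m(-7) and is exact for
  \<open>K >= m\<close>. The separate cutoff lets the recurrence compare neighbouring values of
  \<open>m\<close>.\<close>

definition cheb_sum :: "nat \<Rightarrow> nat \<Rightarrow> rat" where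
  "cheb_sum m K = (\<Sum>j\<le>K. (-16) ^ j * cheb_coeff m j)"

lemma cheb_sum_rec:
  "cheb_sum (Suc (Suc m)) (Suc K) + cheb_sum m (Suc K) =
    2 * cheb_sum (Suc m) (Suc K) - 16 * cheb_sum (Suc m) K"
proof -
  have "cheb_sum (Suc (Suc m)) (Suc K) + cheb_sum m (Suc K) = 2 +
      (\<Sum>j\<le>K. (-16) ^ Suc j * (cheb_coeff (Suc (Suc m)) (Suc j) + cheb_coeff m (Suc j)))"
    unfolding cheb_sum_def by (simp only: sum.atMost_Suc_shift distrib_left sum.distrib) simp
  also have "\<dots> = 2 * cheb_sum (Suc m) (Suc K) - 16 * cheb_sum (Suc m) K"
    unfolding cheb_sum_def cheb_coeff_rec
    by (simp only: sum.atMost_Suc_shift distrib_left sum.distrib)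
       (simp add: sum_distrib_left algebra_simps sum_negf)
  finally show ?thesis .
qed

lemma cheb_sum_stable: "m \<le> K \<Longrightarrow> cheb_sum m K = cheb_sum m m"
  unfolding cheb_sum_def by (rule sum.mono_neutral_right) (auto simp: cheb_coeff_eq_0)

text \<open>Both sides obey one second-order recurrence: \<open>omega ^ 2\<close> has trace 14 and
  norm 1, the sign turns 14 into -14, and \<open>cheb_sum_rec\<close> gives 2 - 16 = -14 once the
  cutoffs are stable.\<close>

lemma cheb_sum_eq: "cheb_sum m m = of_int ((-1) ^ m * re (omega ^ (2 * m)))"
proof (induction m rule: induct_nat_012)
  case 0
  show ?case by (simp add: cheb_sum_def)
next
  case 1
  show ?case by (simp add: cheb_sum_def cheb_coeff_def power2_eq_square)
next
  case (ge2 m)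
  have "re (omega ^ (2 * Suc (Suc m))) = 14 * re (omega ^ (2 * Suc m)) - re (omega ^ (2 * m))"
    by (simp add: algebra_simps)
  note rec = this
  have "cheb_sum (Suc (Suc m)) (Suc (Suc m)) = -14 * cheb_sum (Suc m) (Suc m) - cheb_sum m m"
    using cheb_sum_rec[of m "Suc m"] cheb_sum_stable[of m "Suc (Suc m)"]
      cheb_sum_stable[of "Suc m" "Suc (Suc m)"] by simp
  then show ?case unfolding ge2 rec by (simp add: algebra_simps)
qed

text \<open>With k = 2 j, each factor of the product is 16 times a factor from
  \<open>cheb_coeff\<close>; with the sign this makes (-16)^j.\<close>

lemma alternating_sum_eq:
  "alternating_sum (4 * m) = of_int ((-1) ^ m * re (omega ^ (2 * m)))"
proof -
  have set: "{k. k \<le> 4 * m div 2 \<and> even k} = (\<lambda>j. 2 * j) ` {..m}"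
    by (auto elim!: evenE)
  have "alternating_sum (4 * m) =
      (\<Sum>j\<le>m. (-1) ^ j * ((\<Prod>l<j. (4 * of_nat m)\<^sup>2 - (4 * of_nat l)\<^sup>2) / fact (2 * j)))"
    unfolding alternating_sum_def set by (subst sum.reindex) (auto simp: inj_on_def)
  also have "\<dots> = cheb_sum m m"
    unfolding cheb_sum_def
  proof (rule sum.cong)
    fix j
    have "(\<Prod>l<j. (4 * of_nat m)\<^sup>2 - (4 * of_nat l)\<^sup>2) =
        (\<Prod>l<j. 16 * ((of_nat m)\<^sup>2 - (of_nat l)\<^sup>2) :: rat)"
      by (simp add: power2_eq_square algebra_simps)
    also have "\<dots> = 16 ^ j * (\<Prod>l<j. (of_nat m)\<^sup>2 - (of_nat l)\<^sup>2)"
      by (simp only: prod.distrib prod_constant card_lessThan)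
    finally show "(-1) ^ j * ((\<Prod>l<j. (4 * of_nat m)\<^sup>2 - (4 * of_nat l)\<^sup>2) / fact (2 * j))
        = (-16) ^ j * cheb_coeff m j"
      by (simp add: cheb_coeff_def power_minus[of 16])
  qed simp
  finally show ?thesis by (simp add: cheb_sum_eq)
qed

lemma int_dvd_rat_of_int [simp]: "int_dvd_rat m (of_int s) \<longleftrightarrow> m dvd s"
  by (simp add: int_dvd_rat_def)

lemma mersenne_prime_iff_alternating_sum:
  assumes "odd p" "p \<ge> 3"
  shows "prime (2 ^ p - 1 :: nat) \<longleftrightarrow>
    int_dvd_rat (2 * int (2 ^ (p - 1)) - 1) (alternating_sum (2 ^ (p - 1)))"
proof -
  \<comment> \<open>Now 2^(p-1) = 4 m with m = 2^s, and 2 m = 2^(p-2) is the exponent of the test.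
    The sign (-1)^m does not affect divisibility.\<close>
  obtain s where s: "p = s + 3" using assms(2) by (metis add.commute le_Suc_ex)
  have "int_dvd_rat (2 * int (2 ^ (p - 1)) - 1) (alternating_sum (2 ^ (p - 1))) \<longleftrightarrow>
      int (2 ^ p - 1) dvd re (omega ^ 2 ^ (p - 2))"
    using alternating_sum_eq[of "2 ^ s"]
    by (simp add: s power_add of_nat_diff minus_one_power_iff mult.commute del: of_int_mult)
  moreover have "p \<ge> 2" using assms(2) by simp
  ultimately show ?thesis
    using Lucas_Lehmer_sufficient[of p] Lucas_Lehmer_necessary[OF _ assms] by blast
qed

section \<open>The Euclid-Euler theorem\<close>

definition divisor_sum :: "nat \<Rightarrow> nat" where
  "divisor_sum n = \<Sum>{d. d dvd n}"

lemma perfect_iff_divisor_sum: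
  assumes "n > 0"
  shows "perfect n \<longleftrightarrow> divisor_sum n = 2 * n"
proof -
  have "{d. d dvd n} = insert n {d. d dvd n \<and> d < n}"
    using assms by (auto dest: dvd_imp_le)
  then have "divisor_sum n = n + \<Sum>{d. d dvd n \<and> d < n}"
    unfolding divisor_sum_def by simp
  then show ?thesis using assms by (auto simp: perfect_def)
qed

lemma divisor_sum_prime: "prime n \<Longrightarrow> divisor_sum n = n + 1"
proof -
  assume "prime n"
  then have "{d. d dvd n} = {1, n}" "n \<noteq> 1" by (auto simp: prime_nat_iff)
  then show ?thesis by (simp add: divisor_sum_def)
qed

text \<open>Each factor 2 added keeps the odd divisors, those of \<open>m\<close>, and makes the
  even ones the doubles of all previous divisors.\<close>

lemma divisor_sum_pow2_mult:
  assumes "odd m"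
  shows "divisor_sum (2 ^ k * m) = (2 ^ Suc k - 1) * divisor_sum m"
proof (induction k)
  case (Suc k)
  have m: "m > 0" using assms by (simp add: odd_pos)
  have "{d. d dvd 2 ^ Suc k * m} = {d. d dvd m} \<union> (\<lambda>d. 2 * d) ` {d. d dvd 2 ^ k * m}"
  proof (intro equalityI subsetI)
    fix d assume d: "d \<in> {d. d dvd 2 ^ Suc k * m}"
    show "d \<in> {d. d dvd m} \<union> (\<lambda>d. 2 * d) ` {d. d dvd 2 ^ k * m}"
    proof (cases "even d")
      case True
      then obtain e where e: "d = 2 * e" by (elim evenE)
      with d have "e dvd 2 ^ k * m" by (simp add: mult.assoc)
      with e show ?thesis by blast
    next
      case False
      then have "coprime d (2 ^ Suc k)" by simp
      with d show ?thesis by (auto simp only: coprime_dvd_mult_right_iff mem_Collect_eq)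
    qed
  next
    fix d assume "d \<in> {d. d dvd m} \<union> (\<lambda>d. 2 * d) ` {d. d dvd 2 ^ k * m}"
    then consider "d dvd m" | e where "d = 2 * e" "e dvd 2 ^ k * m" by blast
    then show "d \<in> {d. d dvd 2 ^ Suc k * m}"
      by cases (simp_all add: mult.assoc)
  qed
  moreover have "{d. d dvd m} \<inter> (\<lambda>d. 2 * d) ` {d. d dvd 2 ^ k * m} = {}"
    using assms by auto
  ultimately have "divisor_sum (2 ^ Suc k * m) =
      divisor_sum m + (\<Sum>d\<in>(\<lambda>d. 2 * d) ` {d. d dvd 2 ^ k * m}. d)"
    unfolding divisor_sum_def using m by (simp add: sum.union_disjoint)
  also have "(\<Sum>d\<in>(\<lambda>d. 2 * d) ` {d. d dvd 2 ^ k * m}. d) = 2 * divisor_sum (2 ^ k * m)"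
    by (subst sum.reindex) (auto simp: inj_on_def divisor_sum_def sum_distrib_left)
  finally show ?case
    unfolding Suc by (simp add: algebra_simps diff_mult_distrib)
qed simp

lemma Euclid_perfect:
  assumes "prime (2 ^ p - 1 :: nat)" "p \<ge> 2"
  shows "perfect (2 ^ (p - 1) * (2 ^ p - 1))"
proof -
  have gt: "(2::nat) ^ p > 1" using assms(2) by (intro one_less_power) simp_all
  have "odd (2 ^ p - 1 :: nat)" using assms(2) by simp
  from divisor_sum_pow2_mult[OF this, of "p - 1"] divisor_sum_prime[OF assms(1)]
  have "divisor_sum (2 ^ (p - 1) * (2 ^ p - 1)) = (2 ^ p - 1) * 2 ^ p"
    using assms(2) gt by simp
  also have "\<dots> = 2 * (2 ^ (p - 1) * (2 ^ p - 1))"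
    using assms(2) by (cases p) (simp_all add: algebra_simps)
  finally show ?thesis
    by (subst perfect_iff_divisor_sum) (use gt in simp_all)
qed

text \<open>For N = 2^k m with \<open>m\<close> odd and T = 2^(k+1), perfection reads (T - 1)
  sigma(m) = T m. Hence m = (T - 1) c and sigma(m) = m + c, so \<open>c\<close> and \<open>m\<close>
  are the only divisors of \<open>m\<close>; thus c = 1 and m = T - 1 is prime.\<close>

lemma Euler_even_perfect:
  assumes "even N" "perfect N"
  obtains p where "p \<ge> 2" "prime (2 ^ p - 1 :: nat)" "N = 2 ^ (p - 1) * (2 ^ p - 1)"
proof -
  have N: "N > 0" using assms(2) by (simp add: perfect_def)
  then obtain k m where km: "N = 2 ^ k * m" "odd m"
    by (metis not_gr_zero multiplicity_decompose' odd_one)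
  have k: "k \<ge> 1" using assms(1) km by (cases k) auto
  define T :: nat where "T = 2 ^ Suc k"
  have T: "T \<ge> 4" using power_increasing[of 2 "Suc k" "2::nat"] k by (simp add: T_def)
  have m: "m > 0" using km by (simp add: odd_pos)
  have eq: "(T - 1) * divisor_sum m = T * m"
    using assms(2) N divisor_sum_pow2_mult[OF km(2), of k]
    by (simp add: perfect_iff_divisor_sum km(1) T_def)
  have "coprime (T - 1) T"
    using coprime_diff_one_left_nat[of T] T by simp
  then have "T - 1 dvd m"
    using eq by (metis coprime_dvd_mult_right_iff dvd_triv_left)
  then obtain c where c: "m = (T - 1) * c" by (auto elim!: dvdE)
  have c0: "c > 0" using m c by (cases c) auto
  have "(T - 1) * divisor_sum m = (T - 1) * (T * c)" using eq c by (simp add: ac_simps)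
  then have "divisor_sum m = T * c" using T by simp
  also have "\<dots> = m + c" using c T by (cases T) auto
  finally have \<sigma>: "divisor_sum m = m + c" .
  have "1 * c < (T - 1) * c" using c0 T by (intro mult_strict_right_mono) auto
  then have cm: "c < m" using c by simp
  have fin: "finite {d. d dvd m}" using m by simp
  have only: "d = c \<or> d = m" if "d dvd m" for d
  proof (rule ccontr)
    assume d: "\<not> (d = c \<or> d = m)"
    have "\<Sum>{d, c, m} \<le> divisor_sum m"
      unfolding divisor_sum_def by (rule sum_mono2[OF fin]) (use that c in auto)
    then have "d = 0" using d cm \<sigma> by auto
    then show False using that m by simp
  qed
  have c1: "c = 1" using only[of 1] cm c0 by auto
  have "prime m" using only cm c1 by (auto simp: prime_nat_iff)
  show ?thesis
    by (rule that[of "Suc k"]) (use k km c c1 \<open>prime m\<close> in \<open>auto simp: T_def\<close>)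
qed

text \<open>A divisor a of \<open>p\<close> yields the divisor 2^a - 1 of 2^p - 1.\<close>

lemma mersenne_exponent_prime:
  assumes "prime (2 ^ p - 1 :: nat)"
  shows "prime p"
proof -
  have "p \<noteq> 0" "p \<noteq> 1" using assms by (auto intro: ccontr)
  then have p: "p > 1" by simp
  moreover have "a = 1 \<or> a = p" if dvd: "a dvd p" for a
  proof -
    obtain b where b: "p = a * b" using dvd by (elim dvdE)
    have a: "a > 0" using b p by (cases a) auto
    have "(2 ^ a - 1 :: int) dvd (2 ^ a) ^ b - 1 ^ b" by (rule diff_dvd_power_diff)
    then have "int (2 ^ a - 1) dvd int (2 ^ p - 1)"
      by (simp add: of_nat_diff b power_mult)
    then have "(2 ^ a - 1 :: nat) dvd 2 ^ p - 1" by (simp only: of_nat_dvd_iff)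
    then consider "2 ^ a - 1 = (1::nat)" | "2 ^ a - 1 = (2 ^ p - 1 :: nat)"
      using assms by (auto simp: prime_nat_iff)
    then show ?thesis
    proof cases
      case 1
      then have "(2::nat) ^ a = 2 ^ 1" by simp
      then show ?thesis by (simp only: power_inject_exp) simp
    next
      case 2
      have "(2::nat) ^ a > 0" "(2::nat) ^ p > 0" by simp_all
      with 2 have "(2::nat) ^ a = 2 ^ p" by linarith
      then show ?thesis by simp
    qed
  qed
  ultimately show ?thesis by (auto simp: prime_nat_iff)
qed

theorem theorem6:
  fixes N :: nat
  assumes "N \<noteq> 6"
  shows "(even N \<and> perfect N) \<longleftrightarrow>
    (\<exists>p::nat. prime p \<and> N = 2 ^ (p - 1) * (2 ^ p - 1) \<and>
       (let n = 2 ^ (p - 1) in int_dvd_rat (2 * int n - 1) (alternating_sum n)))"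
proof -
  \<comment> \<open>The exponent 2 would give N = 6, which is excluded; the remaining primes are
    odd.\<close>
  have odd_exponent: "odd p \<and> p \<ge> 3" if "prime p" "N = 2 ^ (p - 1) * (2 ^ p - 1)" for p
  proof -
    have "p \<noteq> 2" using that(2) assms by auto
    then show ?thesis
      using that(1) prime_ge_2_nat[of p] primes_dvd_imp_eq[of 2 p] by auto
  qed
  show ?thesis
  proof
    assume "even N \<and> perfect N"
    then obtain p where p: "prime (2 ^ p - 1 :: nat)" "N = 2 ^ (p - 1) * (2 ^ p - 1)"
      using Euler_even_perfect by blast
    from p(1) have "prime p" by (rule mersenne_exponent_prime)
    with p(2) have odd: "odd p" "p \<ge> 3" using odd_exponent by simp_all
    have "int_dvd_rat (2 * int (2 ^ (p - 1)) - 1) (alternating_sum (2 ^ (p - 1)))"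
      using p(1) mersenne_prime_iff_alternating_sum[OF odd] by (rule iffD1[rotated])
    with \<open>prime p\<close> p(2) show "\<exists>p::nat. prime p \<and> N = 2 ^ (p - 1) * (2 ^ p - 1) \<and>
       (let n = 2 ^ (p - 1) in int_dvd_rat (2 * int n - 1) (alternating_sum n))"
      unfolding Let_def by (intro exI[of _ p] conjI)
  next
    assume "\<exists>p::nat. prime p \<and> N = 2 ^ (p - 1) * (2 ^ p - 1) \<and>
       (let n = 2 ^ (p - 1) in int_dvd_rat (2 * int n - 1) (alternating_sum n))"
    then obtain p where p: "prime p" "N = 2 ^ (p - 1) * (2 ^ p - 1)"
      "int_dvd_rat (2 * int (2 ^ (p - 1)) - 1) (alternating_sum (2 ^ (p - 1)))"
      unfolding Let_def by blast
    from odd_exponent[OF p(1,2)] have odd: "odd p" "p \<ge> 3" by simp_all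
    with p(3) have "prime (2 ^ p - 1 :: nat)"
      using mersenne_prime_iff_alternating_sum by blast
    from Euclid_perfect[OF this] odd p(2) show "even N \<and> perfect N" by simp
  qed
qed

end
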